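(* Let $H$ be a separable real Hilbert space, $U\subset H$ a closed subspace, and $Q\in L(H)$ a nonnegative self-adjoint nuclear operator such that $U$ and $U^\perp$ are $Q$-invariant. Fix $\sigma^2\in(0,\infty)$ and consider the statistical model $(\mathbb{P}_\zeta)_{\zeta\in U}$ on $H$ with $\mathbb{P}_\zeta=\mathrm{N}(\zeta,\sigma^2Q)$, with observation $Y$, and let $\widehat{\zeta}(Y):=\Pi_UY$. Let $b\in H$ with $\langle Qb,\Pi_Ub\rangle>0$ and $\alpha\in(0,1)$ be arbitrary. Then the random interval $$\langle b,\widehat{\zeta}(Y)\rangle\pm z_{1-\frac{\alpha}{2}}\,\sigma\sqrt{\langle Qb,\Pi_Ub\rangle}$$ is a $(1-\alpha)$-confidence interval for $\langle b,\zeta\rangle$.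
   Context: A subspace $V$ is $Q$-invariant if $Q(V)\subset V$. $\Pi_V$ is the orthogonal projection onto a closed subspace $V$. $\mathrm{N}(\zeta,\sigma^2Q)$ is the Gaussian measure on $H$ with mean $\zeta$ and covariance operator $\sigma^2Q$, i.e. if $Y$ has this law then $\langle b,Y\rangle\sim\mathrm{N}(\langle b,\zeta\rangle,\sigma^2\langle Qb,b\rangle)$ (possibly degenerate) for all $b\in H$. $Y$ is the observation (the identity map on $H$), so $Y\sim\mathrm{N}(\zeta,\sigma^2Q)$ under $\mathbb{P}_\zeta$. For $a\in(0,1)$, $z_a$ is the $a$-quantile of the standard normal distribution $\mathrm{N}(0,1)$. The notation $x\pm r$ means the interval $[x-r,x+r]$. A random interval $I(Y)$ is a $(1-\alpha)$-confidence interval for $\langle b,\zeta\rangle$ if $\mathbb{P}_\zeta(\langle b,\zeta\rangle\in I(Y))\ge1-\alpha$ for every $\zeta\in U$. *)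

theory Defs
  imports "HOL-Probability.Probability"
begin

text \<open>A separable real Hilbert space is a type of sort
  \<open>{real_inner, polish_space}\<close>: a complete real inner product space whose topology is
  second countable, which for a metric topology is the same as separable. Finite and infinite
  dimensions are both covered.\<close>

definition orth_proj :: "'a::real_inner set \<Rightarrow> 'a \<Rightarrow> 'a" where
  "orth_proj V x = (THE v. v \<in> V \<and> x - v \<in> orthogonal_comp V)"

definition invariant_under :: "('a \<Rightarrow> 'a) \<Rightarrow> 'a set \<Rightarrow> bool" where
  "invariant_under Q V \<longleftrightarrow> Q ` V \<subseteq> V"

definition self_adjoint :: "('a::real_inner \<Rightarrow> 'a) \<Rightarrow> bool" where
  "self_adjoint Q \<longleftrightarrow> (\<forall>x y. inner (Q x) y = inner x (Q y))"

definition nonneg_operator :: "('a::real_inner \<Rightarrow> 'a) \<Rightarrow> bool" where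
  "nonneg_operator Q \<longleftrightarrow> (\<forall>x. inner (Q x) x \<ge> 0)"

definition nuclear :: "('a::real_inner \<Rightarrow> 'a) \<Rightarrow> bool" where
  "nuclear Q \<longleftrightarrow>
     (\<exists>a c :: nat \<Rightarrow> 'a. summable (\<lambda>n. norm (a n) * norm (c n)) \<and>
        (\<forall>x. (\<lambda>n. inner (a n) x *\<^sub>R c n) sums Q x))"

text \<open>The one-dimensional normal law with mean \<open>m\<close> and variance \<open>v\<close>; variance zero gives the
  point mass at \<open>m\<close>. The library's \<open>normal_density\<close> takes the standard deviation.\<close>

definition normal_law :: "real \<Rightarrow> real \<Rightarrow> real measure" where
  "normal_law m v =
     (if v = 0 then return borel m else density lborel (normal_density m (sqrt v)))"

text \<open>\<open>gaussian_measure M m C\<close>: the Borel probability measure \<open>M\<close> is the Gaussian measure with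
  mean \<open>m\<close> and covariance operator \<open>C\<close>. The laws of all continuous linear functionals determine
  a Borel measure on a separable Hilbert space, so at most one \<open>M\<close> satisfies this.\<close>

definition gaussian_measure :: "'a::{real_inner, polish_space} measure \<Rightarrow> 'a \<Rightarrow> ('a \<Rightarrow> 'a) \<Rightarrow> bool" where
  "gaussian_measure M m C \<longleftrightarrow>
     prob_space M \<and> sets M = sets borel \<and>
     (\<forall>b. distr M borel (\<lambda>y. inner b y) = normal_law (inner b m) (inner (C b) b))"

definition quantile :: "real measure \<Rightarrow> real \<Rightarrow> real" where
  "quantile M a = Inf {x. a \<le> cdf M x}"

abbreviation std_normal_quantile :: "real \<Rightarrow> real" where
  "std_normal_quantile a \<equiv> quantile std_normal_distribution a"

text \<open>\<open>I y\<close> is the interval computed from the observation \<open>y\<close>, the observation being the identity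
  map on the sample space; \<open>g \<theta>\<close> is the quantity of interest. For \<open>\<gamma> > 0\<close> the inequality forces
  the coverage event to be measurable, because \<open>measure\<close> is zero on nonmeasurable sets.\<close>

definition confidence_interval ::
    "('p \<Rightarrow> 'a measure) \<Rightarrow> 'p set \<Rightarrow> real \<Rightarrow> ('p \<Rightarrow> real) \<Rightarrow> ('a \<Rightarrow> real set) \<Rightarrow> bool" where
  "confidence_interval P \<Theta> \<gamma> g I \<longleftrightarrow>
     (\<forall>\<theta>\<in>\<Theta>. measure (P \<theta>) {y \<in> space (P \<theta>). g \<theta> \<in> I y} \<ge> \<gamma>)"

end

theory Submission
  imports Defs
begin

text \<open>
  Write \<open>p = \<Pi>\<^sub>U b\<close>. The projection is self-adjoint and fixes \<open>U\<close>, so the estimator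
  \<open>\<langle>b, \<Pi>\<^sub>U Y\<rangle>\<close> is the continuous linear functional \<open>\<langle>p, Y\<rangle>\<close> of the observation, and its target
  \<open>\<langle>b, \<zeta>\<rangle>\<close> is \<open>\<langle>p, \<zeta>\<rangle>\<close>. Under \<open>\<zeta>\<close> the estimator is therefore normal with mean \<open>\<langle>b, \<zeta>\<rangle>\<close> and
  variance \<open>\<sigma>\<^sup>2 \<langle>Q p, p\<rangle>\<close>. Since \<open>b - p\<close> lies in \<open>U\<^sup>\<bottom>\<close>, which \<open>Q\<close> preserves,
  \<open>\<langle>Q (b - p), p\<rangle> = 0\<close>; hence \<open>\<langle>Q p, p\<rangle> = \<langle>Q b, p\<rangle>\<close>, the quantity in the half-width of the interval
  (lemma \<open>inner_invariant_orth_proj\<close>). The standardized error \<open>Z\<close> and its negative are both standard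
  normal, so each exceeds the \<open>1 - \<alpha>/2\<close> quantile with probability at most \<open>\<alpha>/2\<close>, and the union
  bound gives the coverage (lemma \<open>normal_two_sided_coverage\<close>).

  Everything rests on the existence of the projection onto a closed subspace of a Hilbert space
  (lemma \<open>orth_proj_exists\<close>), obtained as usual from completeness and the parallelogram law.
\<close>

section \<open>Orthogonal projection onto a closed subspace\<close>

text \<open>The near-minimizers of the distance from \<open>x\<close> to \<open>U\<close> form nested closed sets. By the
  parallelogram law at the midpoint \<open>m\<close> of \<open>u\<close> and \<open>v\<close>,
  \<open>\<parallel>u - v\<parallel>\<^sup>2 = 2 \<parallel>x - u\<parallel>\<^sup>2 + 2 \<parallel>x - v\<parallel>\<^sup>2 - 4 \<parallel>x - m\<parallel>\<^sup>2\<close>, so the diameters of these sets tend to zero and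
  completeness yields a common point, which is a minimizer. Minimality along every line through it
  in \<open>U\<close> makes the residual orthogonal to \<open>U\<close>.\<close>

lemma orth_proj_exists:
  fixes U :: "'a::{real_inner, complete_space} set"
  assumes U: "subspace U" "closed U"
  shows "\<exists>v. v \<in> U \<and> x - v \<in> orthogonal_comp U"
proof -
  define d where "d = (INF u\<in>U. (norm (x - u))\<^sup>2)"
  define S where "S n = {u \<in> U. (norm (x - u))\<^sup>2 \<le> d + 1 / real (Suc n)}" for n
  have U0: "U \<noteq> {}"
    using subspace_0[OF U(1)] by auto
  have bdd: "bdd_below ((\<lambda>u. (norm (x - u))\<^sup>2) ` U)"
    by (rule bdd_belowI2[where m = 0]) simp
  have d_le: "d \<le> (norm (x - u))\<^sup>2" if "u \<in> U" for u
    unfolding d_def by (rule cINF_lower[OF bdd that])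
  have closed: "closed (S n)" for n
  proof -
    have "S n = U \<inter> {u. (norm (x - u))\<^sup>2 \<le> d + 1 / real (Suc n)}"
      by (auto simp: S_def)
    moreover have "closed {u. (norm (x - u))\<^sup>2 \<le> d + 1 / real (Suc n)}"
      by (intro closed_Collect_le continuous_intros)
    ultimately show ?thesis
      using U(2) by auto
  qed
  have nonempty: "S n \<noteq> {}" for n
  proof -
    have "d < d + 1 / real (Suc n)" by simp
    then obtain u where "u \<in> U" "(norm (x - u))\<^sup>2 < d + 1 / real (Suc n)"
      using U0 bdd unfolding d_def by (subst (asm) cINF_less_iff) auto
    then show ?thesis by (auto simp: S_def intro!: less_imp_le)
  qed
  have nested: "S n \<subseteq> S m" if "m \<le> n" for m n
  proof -
    have "1 / real (Suc n) \<le> 1 / real (Suc m)"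
      using that by (simp add: frac_le)
    then show ?thesis by (auto simp: S_def)
  qed
  have small: "\<exists>n. \<forall>u\<in>S n. \<forall>v\<in>S n. dist u v < \<epsilon>" if "\<epsilon> > 0" for \<epsilon> :: real
  proof -
    obtain n where n: "1 / real (Suc n) < \<epsilon>\<^sup>2 / 4"
      by (rule nat_approx_posE[of "\<epsilon>\<^sup>2 / 4"]) (use \<open>\<epsilon> > 0\<close> in auto)
    have "dist u v < \<epsilon>" if u: "u \<in> S n" and v: "v \<in> S n" for u v
    proof -
      have "(1/2) *\<^sub>R (u + v) \<in> U"
        using u v U(1) by (auto simp: S_def intro!: subspace_scale subspace_add)
      then have "d \<le> (norm (x - (1/2) *\<^sub>R (u + v)))\<^sup>2"
        by (rule d_le)
      moreover have "(norm (u - v))\<^sup>2 = 2 * (norm (x - u))\<^sup>2 + 2 * (norm (x - v))\<^sup>2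
          - 4 * (norm (x - (1/2) *\<^sub>R (u + v)))\<^sup>2"
        unfolding power2_norm_eq_inner
        by (simp add: inner_diff_left inner_diff_right inner_add_left inner_add_right
            inner_commute field_simps)
      moreover have "(norm (x - u))\<^sup>2 \<le> d + 1 / real (Suc n)" "(norm (x - v))\<^sup>2 \<le> d + 1 / real (Suc n)"
        using u v by (auto simp: S_def)
      ultimately have "(norm (u - v))\<^sup>2 < \<epsilon>\<^sup>2"
        using n by linarith
      then show ?thesis
        using \<open>\<epsilon> > 0\<close> by (simp add: dist_norm power2_less_imp_less)
    qed
    then show ?thesis by blast
  qed
  obtain a where a: "\<And>n. a \<in> S n"
    using decreasing_closed_nest[of S, OF closed nonempty nested small] by metis
  have aU: "a \<in> U"
    using a[of 0] by (simp add: S_def)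
  have near_min: "(norm (x - a))\<^sup>2 \<le> d + 1 / real (Suc n)" for n
    using a[of n] by (simp add: S_def)
  have a_min: "(norm (x - a))\<^sup>2 \<le> d"
  proof (rule field_le_epsilon)
    fix e :: real
    assume "e > 0"
    then obtain n where "1 / real (Suc n) < e"
      by (rule nat_approx_posE)
    then show "(norm (x - a))\<^sup>2 \<le> d + e"
      using near_min[of n] by linarith
  qed
  have "inner y (x - a) = 0" if y: "y \<in> U" for y
  proof (cases "y = 0")
    case False
    \<comment> \<open>The step along \<open>y\<close> that minimizes the distance to \<open>x\<close>.\<close>
    define t where "t = inner y (x - a) / inner y y"
    have "a + t *\<^sub>R y \<in> U"
      using aU y U(1) by (intro subspace_add subspace_scale)
    then have "(norm (x - a))\<^sup>2 \<le> (norm (x - (a + t *\<^sub>R y)))\<^sup>2"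
      using a_min d_le by (meson order_trans)
    also have "x - (a + t *\<^sub>R y) = (x - a) - t *\<^sub>R y"
      by simp
    also have "(norm \<dots>)\<^sup>2 = (norm (x - a))\<^sup>2 - 2 * t * inner y (x - a) + t * t * inner y y"
      using dot_norm_neg[of "x - a" "t *\<^sub>R y"]
      by (simp add: inner_commute power_mult_distrib power2_norm_eq_inner power2_eq_square[of t]
          field_simps)
    also have "t * t * inner y y = t * inner y (x - a)"
      using False by (simp add: t_def)
    finally have "(inner y (x - a))\<^sup>2 / inner y y \<le> 0"
      by (simp add: t_def power2_eq_square)
    moreover have "inner y y > 0"
      using False by simp
    ultimately show ?thesis
      by (auto simp only: divide_le_0_iff power2_less_eq_zero_iff not_le[symmetric])
  qed simp
  then show ?thesis
    using aU by (auto simp: orthogonal_comp_def orthogonal_def)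
qed

lemma inner_orthogonal_comp_eq_0:
  assumes "u \<in> U" "w \<in> orthogonal_comp U"
  shows "inner u w = 0" "inner w u = 0"
  using assms by (auto simp: orthogonal_comp_def orthogonal_def inner_commute)

lemma orth_proj_unique:
  assumes U: "subspace U"
    and v: "v \<in> U" "x - v \<in> orthogonal_comp U"
    and w: "w \<in> U" "x - w \<in> orthogonal_comp U"
  shows "v = w"
proof -
  have "v - w \<in> U"
    using U v w by (intro subspace_diff)
  moreover have "v - w \<in> orthogonal_comp U"
    using subspace_diff[OF subspace_orthogonal_comp w(2) v(2)] by simp
  ultimately have "inner (v - w) (v - w) = 0"
    by (rule inner_orthogonal_comp_eq_0)
  then show ?thesis by simp
qed

context
  fixes U :: "'a::{real_inner, complete_space} set"
  assumes U: "subspace U" "closed U"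
begin

lemma orth_proj_props: "orth_proj U x \<in> U \<and> x - orth_proj U x \<in> orthogonal_comp U"
  unfolding orth_proj_def
proof (rule theI')
  show "\<exists>!v. v \<in> U \<and> x - v \<in> orthogonal_comp U"
    using orth_proj_exists[OF U, of x] orth_proj_unique[OF U(1)] by blast
qed

lemmas orth_proj_in = orth_proj_props[THEN conjunct1]
  and orth_proj_residual = orth_proj_props[THEN conjunct2]

lemma inner_orth_proj_left:
  assumes "u \<in> U"
  shows "inner (orth_proj U x) u = inner x u"
  using inner_orthogonal_comp_eq_0(2)[OF assms orth_proj_residual[of x]]
  by (simp add: inner_diff_left)

lemma orth_proj_self_adjoint: "inner (orth_proj U x) y = inner x (orth_proj U y)"
  using inner_orth_proj_left[OF orth_proj_in, of x y] inner_orth_proj_left[OF orth_proj_in, of y x]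
  by (simp add: inner_commute)

text \<open>The residual \<open>x - \<Pi>\<^sub>U x\<close> is mapped into \<open>U\<^sup>\<bottom>\<close> and so contributes nothing. This identifies the
  variance of the estimator.\<close>

lemma inner_invariant_orth_proj:
  assumes Q: "linear Q" and inv: "invariant_under Q (orthogonal_comp U)"
  shows "inner (Q (orth_proj U x)) (orth_proj U x) = inner (Q x) (orth_proj U x)"
proof -
  have "Q (x - orth_proj U x) \<in> orthogonal_comp U"
    using inv orth_proj_residual by (auto simp: invariant_under_def)
  then have "inner (Q (x - orth_proj U x)) (orth_proj U x) = 0"
    by (rule inner_orthogonal_comp_eq_0(2)[OF orth_proj_in])
  then show ?thesis
    by (simp add: linear_diff[OF Q] inner_diff_left)
qed

end

section \<open>Two-sided normal coverage\<close>

text \<open>Right continuity of the distribution function makes the infimum defining the quantile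
  attained; the limits at \<open>\<plusminus>\<infinity>\<close> ensure that the infimum is over a nonempty set bounded below.\<close>

lemma (in real_distribution) cdf_quantile_ge:
  assumes "0 < a" "a < 1"
  shows "a \<le> cdf M (quantile M a)"
proof -
  define S where "S = {x. a \<le> cdf M x}"
  have "eventually (\<lambda>x. a < cdf M x) at_top"
    using cdf_lim_at_top_prob assms(2) by (rule order_tendstoD)
  then obtain x0 where "a < cdf M x0"
    using eventually_happens'[OF trivial_limit_at_top_linorder] by blast
  then have ne: "S \<noteq> {}"
    by (auto simp: S_def intro: less_imp_le)
  have "eventually (\<lambda>x. cdf M x < a) at_bot"
    using cdf_lim_at_bot assms(1) by (rule order_tendstoD)
  then obtain x1 where "\<And>x. x \<le> x1 \<Longrightarrow> cdf M x < a"
    by (auto simp: eventually_at_bot_linorder)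
  then have bdd: "bdd_below S"
    by (intro bdd_belowI[of _ x1]) (auto simp: S_def not_less[symmetric] intro: ccontr)
  have "a \<le> cdf M x" if "quantile M a < x" for x
  proof -
    obtain y where "y \<in> S" "y < x"
      using \<open>quantile M a < x\<close> cInf_less_iff[OF ne bdd, of x] unfolding quantile_def S_def by blast
    then show ?thesis
      using cdf_nondecreasing[of y x] by (auto simp: S_def)
  qed
  then have "eventually (\<lambda>x. a \<le> cdf M x) (at_right (quantile M a))"
    by (auto simp: eventually_at_filter)
  moreover have "(cdf M \<longlongrightarrow> cdf M (quantile M a)) (at_right (quantile M a))"
    using cdf_is_right_cont by (simp add: continuous_within)
  ultimately show ?thesis
    by (intro tendsto_lowerbound) auto
qed

lemma (in prob_space) prob_std_normal_le_quantile:
  assumes Z: "distributed M lborel Z std_normal_density" and "0 < a" "a < 1"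
  shows "a \<le> prob {x \<in> space M. Z x \<le> std_normal_quantile a}"
proof -
  have meas: "Z \<in> measurable M borel"
    using distributed_measurable[OF Z] by simp
  have "a \<le> cdf std_normal_distribution (std_normal_quantile a)"
    using real_distribution.cdf_quantile_ge[OF real_dist_normal_dist assms(2,3)] .
  also have "\<dots> = measure (distr M lborel Z) {.. std_normal_quantile a}"
    by (simp add: cdf_def2 distributed_distr_eq_density[OF Z])
  also have "\<dots> = prob (Z -` {.. std_normal_quantile a} \<inter> space M)"
    using meas by (intro measure_distr) auto
  also have "Z -` {.. std_normal_quantile a} \<inter> space M = {x \<in> space M. Z x \<le> std_normal_quantile a}"
    by auto
  finally show ?thesis .
qed

text \<open>The standardized variable and its negative have the same law, so each tail beyond the
  \<open>1 - \<alpha>/2\<close> quantile has probability at most \<open>\<alpha>/2\<close>, and the union bound adds them.\<close>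

lemma (in prob_space) normal_two_sided_coverage:
  assumes X: "distributed M lborel X (normal_density m s)" and s: "0 < s"
    and \<alpha>: "0 < \<alpha>" "\<alpha> < 1"
  shows "1 - \<alpha> \<le> prob {x \<in> space M. \<bar>X x - m\<bar> \<le> std_normal_quantile (1 - \<alpha> / 2) * s}"
proof -
  define z where "z = std_normal_quantile (1 - \<alpha> / 2)"
  define Z where "Z x = (X x - m) / s" for x
  have Z: "distributed M lborel Z std_normal_density"
    using X normal_standard_normal_convert[OF s, of X m] by (simp add: Z_def[abs_def])
  have Zneg: "distributed M lborel (\<lambda>x. - Z x) std_normal_density"
    using normal_density_affine[OF Z, of "-1" 0] by simp
  have [measurable]: "Z \<in> borel_measurable M"
    using distributed_measurable[OF Z] by simp
  have tail: "prob {x \<in> space M. z < W x} \<le> \<alpha> / 2"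
    if W: "distributed M lborel W std_normal_density" for W
  proof -
    have [measurable]: "W \<in> borel_measurable M"
      using distributed_measurable[OF W] by simp
    have "1 - \<alpha> / 2 \<le> prob {x \<in> space M. W x \<le> z}"
      using prob_std_normal_le_quantile[OF W, of "1 - \<alpha> / 2"] \<alpha> by (simp add: z_def)
    moreover have "prob {x \<in> space M. \<not> W x \<le> z} = 1 - prob {x \<in> space M. W x \<le> z}"
      by (rule prob_neg) measurable
    ultimately show ?thesis by (simp add: not_le)
  qed
  have "prob {x \<in> space M. \<not> \<bar>Z x\<bar> \<le> z}
      \<le> prob ({x \<in> space M. z < Z x} \<union> {x \<in> space M. z < - Z x})"
    by (rule finite_measure_mono) (auto simp: abs_le_iff)
  also have "\<dots> \<le> prob {x \<in> space M. z < Z x} + prob {x \<in> space M. z < - Z x}"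
    by (rule measure_Un_le) auto
  also have "\<dots> \<le> \<alpha>"
    using tail[OF Z] tail[OF Zneg] by simp
  finally have "1 - \<alpha> \<le> prob {x \<in> space M. \<bar>Z x\<bar> \<le> z}"
    by (subst (asm) prob_neg) auto
  also have "{x \<in> space M. \<bar>Z x\<bar> \<le> z} = {x \<in> space M. \<bar>X x - m\<bar> \<le> z * s}"
    using s by (simp add: Z_def abs_divide pos_divide_le_eq)
  finally show ?thesis by (simp add: z_def)
qed

lemma gaussian_measure_distributed:
  assumes M: "gaussian_measure M m C" and pos: "0 < inner (C b) b"
  shows "distributed M lborel (inner b) (normal_density (inner b m) (sqrt (inner (C b) b)))"
proof -
  have sets: "sets M = sets borel"
    using M by (simp add: gaussian_measure_def)
  have "inner b \<in> borel_measurable M"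
    by (subst measurable_cong_sets[OF sets refl])
       (intro borel_measurable_continuous_onI continuous_intros)
  moreover have "distr M lborel (inner b) = distr M borel (inner b)"
    by (rule distr_cong) auto
  ultimately show ?thesis
    using M pos by (auto simp: distributed_def gaussian_measure_def normal_law_def)
qed

section \<open>The confidence interval\<close>

theorem theorem6p1:
  fixes U :: "'a::{real_inner, polish_space} set"
    and Q :: "'a \<Rightarrow> 'a"
    and P :: "'a \<Rightarrow> 'a measure"
    and b :: 'a
    and \<sigma> \<alpha> :: real
  assumes "subspace U" and "closed U"
    and "bounded_linear Q" and "nonneg_operator Q" and "self_adjoint Q" and "nuclear Q"
    and "invariant_under Q U" and "invariant_under Q (orthogonal_comp U)"
    and "\<sigma> > 0"
    and "\<And>\<zeta>. \<zeta> \<in> U \<Longrightarrow> gaussian_measure (P \<zeta>) \<zeta> (\<lambda>x. \<sigma>\<^sup>2 *\<^sub>R Q x)"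
    and "inner (Q b) (orth_proj U b) > 0"
    and "0 < \<alpha>" and "\<alpha> < 1"
  shows "confidence_interval P U (1 - \<alpha>) (\<lambda>\<zeta>. inner b \<zeta>)
           (\<lambda>y. let r = std_normal_quantile (1 - \<alpha> / 2) * \<sigma> * sqrt (inner (Q b) (orth_proj U b))
                in {inner b (orth_proj U y) - r .. inner b (orth_proj U y) + r})"
  unfolding confidence_interval_def Let_def
proof
  fix \<zeta> assume \<zeta>: "\<zeta> \<in> U"
  define p where "p = orth_proj U b"
  define v where "v = inner (Q b) p"
  note U = assms(1,2)
  have v: "v > 0"
    using assms(11) by (simp add: v_def p_def)
  interpret prob_space "P \<zeta>"
    using assms(10)[OF \<zeta>] by (simp add: gaussian_measure_def)
  have "inner (Q p) p = v"
    using inner_invariant_orth_proj[OF U bounded_linear.linear[OF assms(3)] assms(8)]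
    by (simp add: p_def v_def)
  then have var: "inner (\<sigma>\<^sup>2 *\<^sub>R Q p) p = \<sigma>\<^sup>2 * v"
    by simp
  have sd: "sqrt (\<sigma>\<^sup>2 * v) = \<sigma> * sqrt v"
    using \<open>\<sigma> > 0\<close> by (simp add: real_sqrt_mult)
  have "distributed (P \<zeta>) lborel (inner p) (normal_density (inner p \<zeta>) (\<sigma> * sqrt v))"
    using gaussian_measure_distributed[OF assms(10)[OF \<zeta>], of p] v \<open>\<sigma> > 0\<close>
    unfolding var sd by simp
  then have "1 - \<alpha> \<le> prob {y \<in> space (P \<zeta>).
      \<bar>inner p y - inner p \<zeta>\<bar> \<le> std_normal_quantile (1 - \<alpha> / 2) * (\<sigma> * sqrt v)}"
    using v \<open>\<sigma> > 0\<close> \<open>0 < \<alpha>\<close> \<open>\<alpha> < 1\<close> by (intro normal_two_sided_coverage) auto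
  moreover have "inner p \<zeta> = inner b \<zeta>"
    unfolding p_def by (rule inner_orth_proj_left[OF U \<zeta>])
  moreover have "inner p y = inner b (orth_proj U y)" for y
    unfolding p_def by (rule orth_proj_self_adjoint[OF U])
  ultimately show "1 - \<alpha> \<le> prob {y \<in> space (P \<zeta>). inner b \<zeta> \<in>
      {inner b (orth_proj U y) - std_normal_quantile (1 - \<alpha> / 2) * \<sigma> * sqrt (inner (Q b) (orth_proj U b)) ..
       inner b (orth_proj U y) + std_normal_quantile (1 - \<alpha> / 2) * \<sigma> * sqrt (inner (Q b) (orth_proj U b))}}"
    by (simp add: abs_le_iff v_def p_def algebra_simps conj_commute)
qed

end
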